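(* Let $1\leq p<\infty$ and let $E=\{f:\mathbb{R}\to\mathbb{R}\}$ be endowed with the (non-metrizable, Hausdorff) locally convex topology generated by the seminorms $q_{x_0}(f)=|f(x_0)|$, $x_0\in\mathbb{R}$. For $n\in\mathbb{N}=\{1,2,\dots\}$ define $\gamma_n:[0,1]\to E$ by $\gamma_n(t)(x)=\max\{1-n|x-t|,0\}$ for $x\in\mathbb{R}$, and let $\gamma:[0,1]\to E$ be the pointwise limit of $(\gamma_n)_n$, i.e. $\gamma(t)(x)=1$ if $x=t$ and $\gamma(t)(x)=0$ if $x\neq t$. Let $0_E:[0,1]\to E$ be the constant map $0$. Then $(\gamma_n)_n$ is a sequence in $L^p([0,1],E)$, $0_E\in L^p([0,1],E)$, and for each $x_0\in\mathbb{R}$ \[ \lVert\gamma_n-0_E\rVert_{\mathcal{L}^p,q_{x_0}}^p\leq\frac{2}{n}, \] hence $\gamma_n\to 0_E$ in $L^p([0,1],E)$. On the other hand, \[ \lambda\left(\{t\in[0,1]:\gamma(t)\neq 0_E(t)\}\right)=1, \] so the pointwise limit is not equal almost everywhere to the limit in $L^p([0,1],E)$. Hence, for functions with values in a non-metrizable locally convex space, convergence in $L^p$ does not imply the existence of a subsequence which converges to the pointwise limit. This shows that functions taking values in a non-metrizable space may exhibit behaviors that do not occur in the metrizable setting.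
   Context: $\lambda$ is Lebesgue measure on $[0,1]$. A function $\gamma:[0,1]\to E$ is Lusin-measurable if for each $\varepsilon>0$ there is a compact $K_\varepsilon\subseteq[0,1]$ with $\lambda([0,1]\setminus K_\varepsilon)\leq\varepsilon$ and $\gamma|_{K_\varepsilon}$ continuous. For a locally convex space $E$, $\mathcal{L}^p([0,1],E)$ is the set of Lusin-measurable $\gamma:[0,1]\to E$ such that $q\circ\gamma\in\mathcal{L}^p([0,1],\mathbb{R})$ for each continuous seminorm $q$ on $E$. $L^p([0,1],E)$ is its quotient by almost everywhere equality (a function is identified with its class), with the locally convex topology defined by the seminorms $\lVert\gamma\rVert_{\mathcal{L}^p,q}=\left(\int_0^1 q(\gamma(t))^p\,dt\right)^{1/p}$, where $q$ ranges over the continuous seminorms on $E$. *)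

theory Defs
  imports "HOL-Analysis.Analysis" "HOL-Library.Function_Algebras"
begin

text \<open>
  The library gives functions their pointwise additive structure but no scalar multiplication.
\<close>

instantiation "fun" :: (type, real_vector) real_vector
begin

definition scaleR_fun :: "real \<Rightarrow> ('a \<Rightarrow> 'b) \<Rightarrow> 'a \<Rightarrow> 'b"
  where "scaleR_fun c f = (\<lambda>x. c *\<^sub>R f x)"

instance
  by standard (auto simp: scaleR_fun_def fun_eq_iff scaleR_add_right scaleR_add_left)

end

definition seminorm :: "('a::real_vector \<Rightarrow> real) \<Rightarrow> bool"
  where "seminorm q \<longleftrightarrow>
    (\<forall>x y. q (x + y) \<le> q x + q y) \<and> (\<forall>c x. q (c *\<^sub>R x) = \<bar>c\<bar> * q x)"

text \<open>
  The generator \<^term>\<open>UNIV\<close> only matters for the empty family, which generates the indiscrete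
  topology.
\<close>

definition seminorm_topology :: "('a::real_vector \<Rightarrow> real) set \<Rightarrow> 'a topology"
  where "seminorm_topology Q =
    topology_generated_by (insert UNIV {{y. q (y - x) < e} | q x e. q \<in> Q \<and> 0 < e})"

text \<open>
  A locally convex space is a real vector space (a type) with a topology generated by seminorms;
  no separation axiom is included.
\<close>

definition locally_convex_topology :: "'a::real_vector topology \<Rightarrow> bool"
  where "locally_convex_topology T \<longleftrightarrow> (\<exists>Q. (\<forall>q\<in>Q. seminorm q) \<and> T = seminorm_topology Q)"

definition continuous_seminorm :: "'a::real_vector topology \<Rightarrow> ('a \<Rightarrow> real) \<Rightarrow> bool"
  where "continuous_seminorm T q \<longleftrightarrow> seminorm q \<and> continuous_map T euclideanreal q"

text \<open>
  A map on \<open>[0,1]\<close> is represented by a total function on the reals. Its values outside \<open>[0,1]\<close> are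
  irrelevant to all the notions below.
\<close>

definition lusin_measurable :: "'a topology \<Rightarrow> (real \<Rightarrow> 'a) \<Rightarrow> bool"
  where "lusin_measurable T f \<longleftrightarrow>
    (\<forall>\<epsilon>>0. \<exists>K. compact K \<and> K \<subseteq> {0..1} \<and> measure lebesgue ({0..1} - K) \<le> \<epsilon> \<and>
      continuous_map (top_of_set K) T f)"

definition Lp_real :: "real \<Rightarrow> (real \<Rightarrow> real) set"
  where "Lp_real p = {f. f \<in> borel_measurable (lebesgue_on {0..1}) \<and>
    integrable (lebesgue_on {0..1}) (\<lambda>t. \<bar>f t\<bar> powr p)}"

definition Lp_fun :: "real \<Rightarrow> 'a::real_vector topology \<Rightarrow> (real \<Rightarrow> 'a) set"
  where "Lp_fun p T = {f. lusin_measurable T f \<and>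
    (\<forall>q. continuous_seminorm T q \<longrightarrow> (\<lambda>t. q (f t)) \<in> Lp_real p)}"

definition Lp_seminorm :: "real \<Rightarrow> ('a \<Rightarrow> real) \<Rightarrow> (real \<Rightarrow> 'a) \<Rightarrow> real"
  where "Lp_seminorm p q f = (\<integral>t. q (f t) powr p \<partial>(lebesgue_on {0..1})) powr (1 / p)"

definition ae_eq :: "(real \<Rightarrow> 'a) \<Rightarrow> (real \<Rightarrow> 'a) \<Rightarrow> bool"
  where "ae_eq f g \<longleftrightarrow> (AE t in lebesgue_on {0..1}. f t = g t)"

definition Lp_rel :: "real \<Rightarrow> 'a::real_vector topology \<Rightarrow> ((real \<Rightarrow> 'a) \<times> (real \<Rightarrow> 'a)) set"
  where "Lp_rel p T = {(f, g). f \<in> Lp_fun p T \<and> g \<in> Lp_fun p T \<and> ae_eq f g}"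

definition Lp_space :: "real \<Rightarrow> 'a::real_vector topology \<Rightarrow> (real \<Rightarrow> 'a) set set"
  where "Lp_space p T = Lp_fun p T // Lp_rel p T"

definition Lp_class :: "real \<Rightarrow> 'a::real_vector topology \<Rightarrow> (real \<Rightarrow> 'a) \<Rightarrow> (real \<Rightarrow> 'a) set"
  where "Lp_class p T f = Lp_rel p T `` {f}"

text \<open>
  The topology on the quotient is generated by the images of the seminorm balls; as the seminorms
  are invariant under almost everywhere equality, these are the balls of the induced seminorms.
\<close>

definition Lp_topology :: "real \<Rightarrow> 'a::real_vector topology \<Rightarrow> (real \<Rightarrow> 'a) set topology"
  where "Lp_topology p T = topology_generated_by
    {Lp_class p T ` {g \<in> Lp_fun p T. Lp_seminorm p q (\<lambda>t. g t - f t) < e} | q f e.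
      continuous_seminorm T q \<and> f \<in> Lp_fun p T \<and> 0 < e}"

definition Lp_limit ::
    "real \<Rightarrow> 'a::real_vector topology \<Rightarrow> (nat \<Rightarrow> real \<Rightarrow> 'a) \<Rightarrow> (real \<Rightarrow> 'a) \<Rightarrow> bool"
  where "Lp_limit p T f g \<longleftrightarrow>
    limitin (Lp_topology p T) (\<lambda>n. Lp_class p T (f n)) (Lp_class p T g) sequentially"

text \<open>
  Two properties that a locally convex space may have: a sequence converging in \<open>L\<^sup>p\<close> has a
  subsequence converging almost everywhere to the \<open>L\<^sup>p\<close>-limit; and the \<open>L\<^sup>p\<close>-limit of a pointwise
  convergent sequence is almost everywhere equal to the pointwise limit.
\<close>

definition Lp_ae_subsequence_property :: "real \<Rightarrow> 'a::real_vector topology \<Rightarrow> bool"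
  where "Lp_ae_subsequence_property p T \<longleftrightarrow>
    (\<forall>f g. (\<forall>n. f n \<in> Lp_fun p T) \<and> g \<in> Lp_fun p T \<and> Lp_limit p T f g \<longrightarrow>
      (\<exists>r::nat \<Rightarrow> nat. strict_mono r \<and>
        (AE t in lebesgue_on {0..1}. limitin T (\<lambda>k. f (r k) t) (g t) sequentially)))"

definition Lp_pointwise_limit_property :: "real \<Rightarrow> 'a::real_vector topology \<Rightarrow> bool"
  where "Lp_pointwise_limit_property p T \<longleftrightarrow>
    (\<forall>f g h. (\<forall>n. f n \<in> Lp_fun p T) \<and> g \<in> Lp_fun p T \<and> Lp_limit p T f g \<and>
        (\<forall>t\<in>{0..1}. limitin T (\<lambda>n. f n t) (h t) sequentially) \<longrightarrow>
      ae_eq h g)"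

definition eval_seminorm :: "real \<Rightarrow> (real \<Rightarrow> real) \<Rightarrow> real"
  where "eval_seminorm x f = \<bar>f x\<bar>"

definition E_topology :: "(real \<Rightarrow> real) topology"
  where "E_topology = seminorm_topology (range eval_seminorm)"

definition tent :: "nat \<Rightarrow> real \<Rightarrow> real \<Rightarrow> real"
  where "tent n t = (\<lambda>x. max (1 - real n * \<bar>x - t\<bar>) 0)"

definition spike :: "real \<Rightarrow> real \<Rightarrow> real"
  where "spike t = (\<lambda>x. if x = t then 1 else 0)"

definition zero_E :: "real \<Rightarrow> real \<Rightarrow> real"
  where "zero_E t = 0"

end

theory Submission
  imports Defs
begin

text \<open>
  A continuous seminorm \<open>q\<close> on \<open>E\<close> is controlled by the values at finitely many points, so \<open>q \<circ> tent n\<close>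
  is bounded uniformly in \<open>n\<close> and converges to \<open>0\<close> off a finite set; dominated convergence gives
  convergence to \<open>0\<close> in \<open>L\<^sup>p\<close>. Pointwise convergence to \<open>0\<close> fails at every \<open>t\<close>, because of the value
  at \<open>x = t\<close>. In a metrizable space countably many seminorms suffice, and a diagonal choice yields an
  almost everywhere convergent subsequence; as \<open>E\<close> violates this conclusion, it is not metrizable.
\<close>

subsection \<open>Topologies generated by seminorms\<close>

text \<open>The null set on which convergence fails depends on the seminorm. For
  \<open>eval_seminorm x\<close> it is at most the single point t = x, but as x runs through [0,1]
  these null sets cover the whole interval. Countably many seminorms would leave a null union, which
  is why a countable neighbourhood base at 0 restores the almost everywhere statement. A second
  difficulty is the topology of the quotient. Its subbasis consists of balls around every centre h,
  so convergence to the class of \<open>zero_E\<close> asks that the seminorms of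
  \<open>tent n - h\<close> eventually drop below each e exceeding that of
  \<open>zero_E - h\<close>. Dominated convergence treats all centres alike, with the crude bound
  \<open>powr_add_le\<close> where one might expect Minkowski's inequality. The map
  \<open>spike\<close> is not Lusin-measurable, so it has no class of its own; it is therefore
  compared with arbitrary Lusin-measurable maps, which settles every possible limit of a
  subsequence, not just \<open>zero_E\<close>.\<close>

lemma seminorm_triangle: "seminorm q \<Longrightarrow> q (x + y) \<le> q x + q y"
  by (simp add: seminorm_def)

lemma seminorm_scaleR: "seminorm q \<Longrightarrow> q (c *\<^sub>R x) = \<bar>c\<bar> * q x"
  by (simp add: seminorm_def)

lemma seminorm_zero: "seminorm q \<Longrightarrow> q 0 = 0"
  using seminorm_scaleR[of q 0 0] by simp

lemma seminorm_minus: "seminorm q \<Longrightarrow> q (- x) = q x"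
  using seminorm_scaleR[of q "-1" x] by simp

lemma seminorm_nonneg: "seminorm q \<Longrightarrow> 0 \<le> q x"
  using seminorm_triangle[of q x "- x"] by (simp add: seminorm_zero seminorm_minus)

lemma seminorm_minus_commute: "seminorm q \<Longrightarrow> q (x - y) = q (y - x)"
  using seminorm_minus[of q "x - y"] by simp

lemma seminorm_diff_triangle: "seminorm q \<Longrightarrow> q (x - z) \<le> q (x - y) + q (y - z)"
  using seminorm_triangle[of q "x - y" "y - z"] by simp

lemma seminorm_diff_le: "seminorm q \<Longrightarrow> q (x - y) \<le> q x + q y"
  using seminorm_triangle[of q x "- y"] by (simp add: seminorm_minus)

lemma seminorm_reverse_triangle: "seminorm q \<Longrightarrow> \<bar>q x - q y\<bar> \<le> q (x - y)"
  using seminorm_triangle[of q "x - y" y] seminorm_triangle[of q "y - x" x]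
    seminorm_minus_commute[of q x y] by simp

lemma seminorm_sum:
  assumes "\<And>i. i \<in> I \<Longrightarrow> seminorm (r i)"
  shows "seminorm (\<lambda>x. \<Sum>i\<in>I. r i x)"
  unfolding seminorm_def
proof (intro conjI allI)
  fix x y
  have "(\<Sum>i\<in>I. r i (x + y)) \<le> (\<Sum>i\<in>I. r i x + r i y)"
    by (intro sum_mono seminorm_triangle assms)
  then show "(\<Sum>i\<in>I. r i (x + y)) \<le> (\<Sum>i\<in>I. r i x) + (\<Sum>i\<in>I. r i y)"
    by (simp add: sum.distrib)
qed (simp add: seminorm_scaleR assms sum_distrib_left)

text \<open>The triangle inequality recentres a subbasic ball at any of its points. Intersecting two
  such neighbourhoods merges the finite families and keeps the smaller radius. The generator
  \<open>UNIV\<close> corresponds to the empty family, so the description also covers empty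
  Q.\<close>

lemma openin_seminorm_topology:
  assumes Q: "\<forall>q\<in>Q. seminorm q"
  shows "openin (seminorm_topology Q) U \<longleftrightarrow>
    (\<forall>x\<in>U. \<exists>F e. finite F \<and> F \<subseteq> Q \<and> 0 < e \<and> {y. \<forall>q\<in>F. q (y - x) < e} \<subseteq> U)"
    (is "_ \<longleftrightarrow> ?nbhd U")
proof
  let ?S = "insert UNIV {{y. q (y - x) < e} | q x e. q \<in> Q \<and> 0 < e}"
  assume "openin (seminorm_topology Q) U"
  then have "generate_topology_on ?S U"
    unfolding seminorm_topology_def by (rule openin_topology_generated_by)
  then show "?nbhd U"
  proof induction
    case Empty
    then show ?case by simp
  next
    case (Int a b)
    show ?case
    proof
      fix x assume x: "x \<in> a \<inter> b"
      obtain F e G d where F: "finite F" "F \<subseteq> Q" "0 < e" "{y. \<forall>q\<in>F. q (y - x) < e} \<subseteq> a"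
        and G: "finite G" "G \<subseteq> Q" "0 < d" "{y. \<forall>q\<in>G. q (y - x) < d} \<subseteq> b"
        using Int.IH x by (meson IntD1 IntD2)
      have "{y. \<forall>q\<in>F \<union> G. q (y - x) < min e d} \<subseteq> a \<inter> b"
        using F(4) G(4) by auto
      then show "\<exists>F e. finite F \<and> F \<subseteq> Q \<and> 0 < e \<and> {y. \<forall>q\<in>F. q (y - x) < e} \<subseteq> a \<inter> b"
        using F(1-3) G(1-3) by (intro exI[of _ "F \<union> G"] exI[of _ "min e d"]) auto
    qed
  next
    case (UN K)
    show ?case
    proof
      fix x assume "x \<in> \<Union>K"
      then obtain k where k: "k \<in> K" "x \<in> k" by blast
      then obtain F e where "finite F" "F \<subseteq> Q" "0 < e" "{y. \<forall>q\<in>F. q (y - x) < e} \<subseteq> k"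
        using UN.IH by meson
      with k show "\<exists>F e. finite F \<and> F \<subseteq> Q \<and> 0 < e \<and> {y. \<forall>q\<in>F. q (y - x) < e} \<subseteq> \<Union>K"
        by (intro exI[of _ F] exI[of _ e]) auto
    qed
  next
    case (Basis s)
    then consider "s = UNIV" | q z e where "s = {y. q (y - z) < e}" "q \<in> Q" "0 < e"
      by blast
    then show ?case
    proof cases
      case 1
      then show ?thesis
        by (intro ballI exI[of _ "{}"] exI[of _ "1::real"]) auto
    next
      case 2
      show ?thesis
      proof
        fix x assume x: "x \<in> s"
        have "q (y - z) < e" if "q (y - x) < e - q (x - z)" for y
          using seminorm_diff_triangle[OF bspec[OF Q 2(2)], of y z x] that by linarith
        then show "\<exists>F e. finite F \<and> F \<subseteq> Q \<and> 0 < e \<and> {y. \<forall>q\<in>F. q (y - x) < e} \<subseteq> s"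
          using 2 x by (intro exI[of _ "{q}"] exI[of _ "e - q (x - z)"]) auto
      qed
    qed
  qed
next
  assume nbhd: "?nbhd U"
  have ball: "openin (seminorm_topology Q) {y. \<forall>q\<in>F. q (y - x) < e}"
    if "finite F" "F \<subseteq> Q" "0 < e" for F x e
    using that
  proof (induction F rule: finite_induct)
    case empty
    then show ?case
      unfolding seminorm_topology_def by (auto intro: topology_generated_by_Basis)
  next
    case (insert q F)
    have "openin (seminorm_topology Q) {y. q (y - x) < e}"
      unfolding seminorm_topology_def using insert by (intro topology_generated_by_Basis) auto
    with insert have "openin (seminorm_topology Q) ({y. q (y - x) < e} \<inter> {y. \<forall>q\<in>F. q (y - x) < e})"
      by (intro openin_Int) auto
    then show ?case
      by (simp add: Collect_conj_eq)
  qed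
  show "openin (seminorm_topology Q) U"
  proof (subst openin_subopen, intro ballI)
    fix x assume "x \<in> U"
    then obtain F e where F: "finite F" "F \<subseteq> Q" "0 < e" "{y. \<forall>q\<in>F. q (y - x) < e} \<subseteq> U"
      using nbhd by meson
    moreover have "x \<in> {y. \<forall>q\<in>F. q (y - x) < e}"
      using F Q by (auto simp: seminorm_zero)
    ultimately show "\<exists>V. openin (seminorm_topology Q) V \<and> x \<in> V \<and> V \<subseteq> U"
      using ball[of F e x] by blast
  qed
qed

lemma topspace_seminorm_topology: "topspace (seminorm_topology Q) = UNIV"
  by (simp add: seminorm_topology_def)

lemma continuous_seminormD:
  assumes "continuous_seminorm T q"
  shows "seminorm q" "continuous_map T euclideanreal q"
  using assms by (auto simp: continuous_seminorm_def)

lemma locally_convex_topspace: "locally_convex_topology T \<Longrightarrow> topspace T = UNIV"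
  by (auto simp: locally_convex_topology_def topspace_seminorm_topology)

text \<open>Continuity at 0, read through the generators. It reduces questions about an arbitrary
  continuous seminorm to finitely many members of Q.\<close>

lemma continuous_seminorm_ball_at_zero:
  assumes Q: "\<forall>q\<in>Q. seminorm q"
    and q: "continuous_seminorm (seminorm_topology Q) q" and "0 < \<delta>"
  obtains F e where "finite F" "F \<subseteq> Q" "0 < e" "\<And>y. (\<And>r. r \<in> F \<Longrightarrow> r y < e) \<Longrightarrow> q y < \<delta>"
proof -
  have "openin (seminorm_topology Q) {y \<in> topspace (seminorm_topology Q). q y \<in> {..<\<delta>}}"
    using q by (intro openin_continuous_map_preimage[of _ euclideanreal]) (auto simp: continuous_seminorm_def)
  moreover have "0 \<in> {y \<in> topspace (seminorm_topology Q). q y \<in> {..<\<delta>}}"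
    using q \<open>0 < \<delta>\<close> by (auto simp: topspace_seminorm_topology continuous_seminorm_def seminorm_zero)
  ultimately obtain F e where "finite F" "F \<subseteq> Q" "0 < e"
    "{y. \<forall>r\<in>F. r (y - 0) < e} \<subseteq> {y \<in> topspace (seminorm_topology Q). q y \<in> {..<\<delta>}}"
    unfolding openin_seminorm_topology[OF Q] by meson
  then show ?thesis
    by (intro that[of F e]) auto
qed

lemma continuous_seminormI:
  assumes Q: "\<forall>q\<in>Q. seminorm q" and "q \<in> Q"
  shows "continuous_seminorm (seminorm_topology Q) q"
proof -
  have "openin (seminorm_topology Q) {y. q y \<in> U}" if "open U" for U
    unfolding openin_seminorm_topology[OF Q]
  proof
    fix x assume "x \<in> {y. q y \<in> U}"
    then obtain e where e: "0 < e" "ball (q x) e \<subseteq> U"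
      using \<open>open U\<close> unfolding open_contains_ball by blast
    have "q y \<in> U" if "q (y - x) < e" for y
      using seminorm_reverse_triangle[OF bspec[OF Q \<open>q \<in> Q\<close>], of y x] that e
      by (auto simp: subset_iff dist_real_def abs_minus_commute)
    then show "\<exists>F e. finite F \<and> F \<subseteq> Q \<and> 0 < e \<and> {y. \<forall>q\<in>F. q (y - x) < e} \<subseteq> {y. q y \<in> U}"
      using \<open>q \<in> Q\<close> e by (intro exI[of _ "{q}"] exI[of _ e]) auto
  qed
  then show ?thesis
    using Q \<open>q \<in> Q\<close> by (auto simp: continuous_seminorm_def continuous_map_def topspace_seminorm_topology)
qed

lemma continuous_seminorm_sum:
  assumes "finite I" "\<And>i. i \<in> I \<Longrightarrow> continuous_seminorm T (r i)"
  shows "continuous_seminorm T (\<lambda>x. \<Sum>i\<in>I. r i x)"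
  using assms seminorm_sum[of I r] continuous_map_sum[of I T "\<lambda>x i. r i x"]
  by (simp add: continuous_seminorm_def)

text \<open>A finite family of generators is dominated by its sum, which is again a continuous
  seminorm. A single seminorm therefore replaces the family, and later arguments no longer mention
  the generators.\<close>

lemma openin_locally_convex:
  assumes T: "locally_convex_topology T"
  shows "openin T U \<longleftrightarrow>
    (\<forall>x\<in>U. \<exists>q e. continuous_seminorm T q \<and> 0 < e \<and> {y. q (y - x) < e} \<subseteq> U)"
proof -
  obtain Q where Q: "\<forall>q\<in>Q. seminorm q" and TQ: "T = seminorm_topology Q"
    using T by (auto simp: locally_convex_topology_def)
  have "(\<exists>q e. continuous_seminorm T q \<and> 0 < e \<and> {y. q (y - x) < e} \<subseteq> U) \<longleftrightarrow>
      (\<exists>F e. finite F \<and> F \<subseteq> Q \<and> 0 < e \<and> {y. \<forall>q\<in>F. q (y - x) < e} \<subseteq> U)" (is "?l = ?r") for x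
  proof
    assume ?l
    then obtain q e where q: "continuous_seminorm T q" "0 < e" "{y. q (y - x) < e} \<subseteq> U" by blast
    obtain F d where "finite F" "F \<subseteq> Q" "0 < d" "\<And>y. (\<And>r. r \<in> F \<Longrightarrow> r y < d) \<Longrightarrow> q y < e"
      using continuous_seminorm_ball_at_zero[OF Q q(1)[unfolded TQ] \<open>0 < e\<close>] by blast
    with q(3) show ?r by (intro exI[of _ F] exI[of _ d]) auto
  next
    assume ?r
    then obtain F e where F: "finite F" "F \<subseteq> Q" "0 < e" "{y. \<forall>q\<in>F. q (y - x) < e} \<subseteq> U" by blast
    let ?q = "\<lambda>y. \<Sum>q\<in>F. q y"
    have "continuous_seminorm T ?q"
      unfolding TQ using F(1,2) by (intro continuous_seminorm_sum continuous_seminormI[OF Q]) auto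
    moreover have "q y \<le> ?q y" if "q \<in> F" for q y
      using F Q that by (intro member_le_sum) (auto intro: seminorm_nonneg)
    then have "{y. ?q (y - x) < e} \<subseteq> U"
      using F(4) by (fastforce intro: le_less_trans)
    ultimately show ?l
      using \<open>0 < e\<close> by blast
  qed
  then show ?thesis
    using openin_seminorm_topology[OF Q, of U] by (simp add: TQ)
qed

lemma openin_seminorm_ball:
  assumes T: "locally_convex_topology T" and q: "continuous_seminorm T q"
  shows "openin T {y. q (y - x) < e}"
  unfolding openin_locally_convex[OF T]
proof
  fix z assume z: "z \<in> {y. q (y - x) < e}"
  have "q (y - x) < e" if "q (y - z) < e - q (z - x)" for y
    using seminorm_diff_triangle[of q y x z] q that by (auto simp: continuous_seminorm_def)
  with z q show "\<exists>r d. continuous_seminorm T r \<and> 0 < d \<and> {y. r (y - z) < d} \<subseteq> {y. q (y - x) < e}"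
    by (intro exI[of _ q] exI[of _ "e - q (z - x)"]) auto
qed

lemma limitin_locally_convex:
  assumes T: "locally_convex_topology T"
  shows "limitin T f l F \<longleftrightarrow> (\<forall>q. continuous_seminorm T q \<longrightarrow> ((\<lambda>n. q (f n - l)) \<longlongrightarrow> 0) F)"
proof safe
  fix q assume lim: "limitin T f l F" and q: "continuous_seminorm T q"
  have "\<forall>\<^sub>F n in F. q (f n - l) < e" if "0 < e" for e
  proof -
    have "l \<in> {y. q (y - l) < e}"
      using q that by (auto simp: continuous_seminorm_def seminorm_zero)
    then have "\<forall>\<^sub>F n in F. f n \<in> {y. q (y - l) < e}"
      using lim openin_seminorm_ball[OF T q] unfolding limitin_def by blast
    then show ?thesis by simp
  qed
  then show "((\<lambda>n. q (f n - l)) \<longlongrightarrow> 0) F"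
    using q by (auto simp: tendsto_iff continuous_seminorm_def seminorm_nonneg)
next
  assume lim: "\<forall>q. continuous_seminorm T q \<longrightarrow> ((\<lambda>n. q (f n - l)) \<longlongrightarrow> 0) F"
  show "limitin T f l F"
    unfolding limitin_def
  proof (intro conjI allI impI)
    fix U assume U: "openin T U \<and> l \<in> U"
    then obtain q e where q: "continuous_seminorm T q" "0 < e" "{y. q (y - l) < e} \<subseteq> U"
      unfolding openin_locally_convex[OF T] by blast
    have "\<forall>\<^sub>F n in F. q (f n - l) < e"
      using lim q(1,2) order_tendstoD(2) by blast
    then show "\<forall>\<^sub>F n in F. f n \<in> U"
      by eventually_elim (use q(3) in blast)
  qed (simp add: locally_convex_topspace[OF T])
qed

lemma continuous_map_locally_convex:
  assumes T: "locally_convex_topology T"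
  shows "continuous_map X T f \<longleftrightarrow> (\<forall>q s e. continuous_seminorm T q \<and> s \<in> topspace X \<and> 0 < e \<longrightarrow>
    (\<exists>U. openin X U \<and> s \<in> U \<and> (\<forall>t\<in>U. q (f t - f s) < e)))"
proof safe
  fix q s and e :: real
  assume f: "continuous_map X T f" and q: "continuous_seminorm T q" and s: "s \<in> topspace X" "0 < e"
  let ?U = "{t \<in> topspace X. f t \<in> {y. q (y - f s) < e}}"
  have "openin X ?U"
    using f openin_seminorm_ball[OF T q] by (rule openin_continuous_map_preimage)
  moreover have "s \<in> ?U"
    using s q by (auto simp: continuous_seminorm_def seminorm_zero)
  ultimately show "\<exists>U. openin X U \<and> s \<in> U \<and> (\<forall>t\<in>U. q (f t - f s) < e)"
    by blast
next
  assume f: "\<forall>q s e. continuous_seminorm T q \<and> s \<in> topspace X \<and> 0 < e \<longrightarrow>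
    (\<exists>U. openin X U \<and> s \<in> U \<and> (\<forall>t\<in>U. q (f t - f s) < e))"
  have "openin X {t \<in> topspace X. f t \<in> V}" if V: "openin T V" for V
  proof (subst openin_subopen, intro ballI)
    fix s assume s: "s \<in> {t \<in> topspace X. f t \<in> V}"
    then obtain q e where q: "continuous_seminorm T q" "0 < e" "{y. q (y - f s) < e} \<subseteq> V"
      using V unfolding openin_locally_convex[OF T] by blast
    then obtain U where U: "openin X U" "s \<in> U" "\<forall>t\<in>U. q (f t - f s) < e"
      using f[rule_format, of q s e] s by blast
    then show "\<exists>U. openin X U \<and> s \<in> U \<and> U \<subseteq> {t \<in> topspace X. f t \<in> V}"
      using q(3) openin_subset[OF U(1)] by (intro exI[of _ U]) auto
  qed
  then show "continuous_map X T f"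
    by (simp add: continuous_map_def locally_convex_topspace[OF T])
qed

lemma continuous_map_locally_convex_diff:
  assumes T: "locally_convex_topology T" and f: "continuous_map X T f" and g: "continuous_map X T g"
  shows "continuous_map X T (\<lambda>t. f t - g t)"
  unfolding continuous_map_locally_convex[OF T]
proof (intro allI impI)
  fix q s and e :: real
  assume *: "continuous_seminorm T q \<and> s \<in> topspace X \<and> 0 < e"
  then have "0 < e/2" by simp
  with * obtain U V where U: "openin X U" "s \<in> U" "\<forall>t\<in>U. q (f t - f s) < e/2"
    and V: "openin X V" "s \<in> V" "\<forall>t\<in>V. q (g t - g s) < e/2"
    using f g unfolding continuous_map_locally_convex[OF T] by meson
  have "q (f t - g t - (f s - g s)) < e" if "t \<in> U \<inter> V" for t
  proof -
    have "q (f t - g t - (f s - g s)) \<le> q (f t - f s) + q (g t - g s)"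
      using seminorm_diff_le[of q "f t - f s" "g t - g s"] *
      by (simp add: continuous_seminorm_def algebra_simps)
    moreover have "q (f t - f s) < e/2" "q (g t - g s) < e/2"
      using U(3) V(3) that by auto
    ultimately show ?thesis
      by linarith
  qed
  then show "\<exists>W. openin X W \<and> s \<in> W \<and> (\<forall>t\<in>W. q (f t - g t - (f s - g s)) < e)"
    using U V by (intro exI[of _ "U \<inter> V"]) auto
qed

subsection \<open>The spaces \<open>L\<^sup>p\<close>\<close>

lemma lusin_measurable_continuous_compose:
  assumes "lusin_measurable T f" "continuous_map T S q"
  shows "lusin_measurable S (\<lambda>t. q (f t))"
  unfolding lusin_measurable_def
proof (intro allI impI)
  fix \<epsilon> :: real assume "0 < \<epsilon>"
  then obtain K where "compact K" "K \<subseteq> {0..1}" "measure lebesgue ({0..1} - K) \<le> \<epsilon>"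
      "continuous_map (top_of_set K) T f"
    using assms(1) unfolding lusin_measurable_def by meson
  then show "\<exists>K. compact K \<and> K \<subseteq> {0..1} \<and> measure lebesgue ({0..1} - K) \<le> \<epsilon> \<and>
      continuous_map (top_of_set K) S (\<lambda>t. q (f t))"
    using continuous_map_compose[OF _ assms(2), unfolded comp_def] by blast
qed

lemma lusin_measurable_diff:
  assumes T: "locally_convex_topology T" and f: "lusin_measurable T f" and g: "lusin_measurable T g"
  shows "lusin_measurable T (\<lambda>t. f t - g t)"
  unfolding lusin_measurable_def
proof (intro allI impI)
  fix \<epsilon> :: real assume "0 < \<epsilon>"
  then have "0 < \<epsilon>/2" by simp
  then obtain K L where K: "compact K" "K \<subseteq> {0..1}" "measure lebesgue ({0..1} - K) \<le> \<epsilon>/2"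
      "continuous_map (top_of_set K) T f"
    and L: "compact L" "L \<subseteq> {0..1}" "measure lebesgue ({0..1} - L) \<le> \<epsilon>/2"
      "continuous_map (top_of_set L) T g"
    using f g unfolding lusin_measurable_def by meson
  have [simp]: "{0..1} - K \<in> lmeasurable" "{0..1} - L \<in> lmeasurable"
    using K(1) L(1) by (auto intro: fmeasurable.Diff lmeasurable_compact)
  have "{0..1} - K \<inter> L = ({0..1} - K) \<union> ({0..1} - L)"
    by auto
  then have "measure lebesgue ({0..1} - K \<inter> L) \<le> \<epsilon>"
    using measure_Un_le[of "{0..1} - K" lebesgue "{0..1} - L"] K(3) L(3) by (simp add: fmeasurableD)
  moreover have "continuous_map (top_of_set (K \<inter> L)) T (\<lambda>t. f t - g t)"
    using K(4) L(4) by (intro continuous_map_locally_convex_diff[OF T])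
      (auto intro: continuous_map_from_subtopology_mono)
  ultimately show "\<exists>M. compact M \<and> M \<subseteq> {0..1} \<and> measure lebesgue ({0..1} - M) \<le> \<epsilon> \<and>
      continuous_map (top_of_set M) T (\<lambda>t. f t - g t)"
    using K L by (intro exI[of _ "K \<inter> L"]) (auto intro: compact_Int)
qed

text \<open>The interval is covered by countably many compact sets on which h is continuous,
  together with a null set N. Measurability is checked on each piece.\<close>

lemma lusin_measurable_imp_borel_measurable:
  assumes "lusin_measurable euclideanreal h"
  shows "h \<in> borel_measurable (lebesgue_on {0..1})"
proof -
  have "\<exists>K. compact K \<and> K \<subseteq> {0..1} \<and> measure lebesgue ({0..1} - K) \<le> 1 / real (Suc n) \<and>
      continuous_on K h" for n
    using assms unfolding lusin_measurable_def by simp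
  then obtain K where K: "\<And>n. compact (K n)" "\<And>n. K n \<subseteq> {0..1}" "\<And>n. continuous_on (K n) h"
    and mK: "\<And>n. measure lebesgue ({0..1} - K n) \<le> 1 / real (Suc n)"
    by metis
  define N where "N = {0..1} - (\<Union>n. K n)"
  have sets_K: "K n \<in> sets lebesgue" for n
    using K(1) by (auto intro: fmeasurableD lmeasurable_compact)
  have N: "N \<in> lmeasurable"
    unfolding N_def using sets_K by (intro fmeasurable_Diff) auto
  have "measure lebesgue N \<le> 1 / real (Suc n)" for n
  proof -
    have "measure lebesgue N \<le> measure lebesgue ({0..1} - K n)"
      using N K(1) by (intro measure_mono_fmeasurable)
        (auto simp: N_def intro: fmeasurable.Diff lmeasurable_compact fmeasurableD)
    with mK[of n] show ?thesis by linarith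
  qed
  then have "measure lebesgue N \<le> 0"
    by (intro LIMSEQ_le_const[OF lim_inverse_n'[THEN LIMSEQ_Suc]]) auto
  then have "measure lebesgue N = 0"
    using measure_nonneg[of lebesgue N] by linarith
  with N have "negligible N"
    by (simp add: negligible_iff_measure)
  \<comment> \<open>Completeness of Lebesgue measure: h is measurable on N whatever values it takes
    there.\<close>
  then have sub: "A \<in> sets lebesgue" if "A \<subseteq> N" for A
    using that by (meson negligible_imp_sets negligible_subset)
  show ?thesis
  proof (rule measurable_piecewise_restrict[of "insert N (range K)"])
    show "\<Omega> \<inter> space (lebesgue_on {0..1}) \<in> sets (lebesgue_on {0..1})" if "\<Omega> \<in> insert N (range K)" for \<Omega>
      using that sets_K N by (auto simp: sets_restrict_space Int_commute intro!: imageI)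
    show "space (lebesgue_on {0..1}) \<subseteq> \<Union> (insert N (range K))"
      by (auto simp: N_def)
    show "h \<in> borel_measurable (restrict_space (lebesgue_on {0..1}) \<Omega>)" if "\<Omega> \<in> insert N (range K)" for \<Omega>
    proof -
      have "\<Omega> \<subseteq> {0..1}"
        using that K(2) by (auto simp: N_def)
      then have "{0..1} \<inter> \<Omega> = \<Omega>"
        by auto
      then have eq: "restrict_space (lebesgue_on {0..1}) \<Omega> = lebesgue_on \<Omega>"
        using that sets_K N by (subst restrict_restrict_space) auto
      show ?thesis
      proof (cases "\<Omega> = N")
        case True
        have "h -` B \<inter> N \<in> sets (lebesgue_on N)" for B
          using sub[of "h -` B \<inter> N"] N by (subst sets_restrict_space_iff) auto
        then have "h \<in> borel_measurable (lebesgue_on N)"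
          by (auto intro!: measurableI)
        then show ?thesis
          unfolding eq using True by simp
      next
        case False
        then show ?thesis
          unfolding eq using that K sets_K by (auto intro: continuous_imp_measurable_on_sets_lebesgue)
      qed
    qed
  qed auto
qed

text \<open>Bounds a + b by twice the maximum. The constant is crude, but only integrability of the
  right-hand side matters, both for closure of \<open>Lp_fun\<close> under differences and for the
  dominating function in \<open>Lp_limit_tent\<close>.\<close>

lemma powr_add_le:
  fixes a b p :: real
  assumes "0 \<le> a" "0 \<le> b" "0 \<le> p"
  shows "(a + b) powr p \<le> 2 powr p * (a powr p + b powr p)"
proof -
  have "(a + b) powr p \<le> (2 * max a b) powr p"
    using assms by (intro powr_mono2) auto
  also have "\<dots> = 2 powr p * max a b powr p"
    using assms by (simp add: powr_mult)
  also have "\<dots> \<le> 2 powr p * (a powr p + b powr p)"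
    by (intro mult_left_mono) (auto simp: max_def)
  finally show ?thesis .
qed

lemma Lp_funD:
  assumes f: "f \<in> Lp_fun p T" and q: "continuous_seminorm T q"
  shows "(\<lambda>t. q (f t)) \<in> borel_measurable (lebesgue_on {0..1})"
    and "integrable (lebesgue_on {0..1}) (\<lambda>t. q (f t) powr p)"
proof -
  have "\<bar>q (f t)\<bar> = q (f t)" for t
    using q by (simp add: continuous_seminorm_def seminorm_nonneg)
  with assms show "(\<lambda>t. q (f t)) \<in> borel_measurable (lebesgue_on {0..1})"
    "integrable (lebesgue_on {0..1}) (\<lambda>t. q (f t) powr p)"
    by (auto simp: Lp_fun_def Lp_real_def)
qed

text \<open>Measurability of \<open>q (f t - g t)\<close> cannot be read off from that of
  \<open>q (f t)\<close> and \<open>q (g t)\<close>. It comes from Lusin-measurability of the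
  difference; integrability then follows from \<open>powr_add_le\<close>.\<close>

lemma Lp_fun_diff:
  assumes T: "locally_convex_topology T" and p: "0 \<le> p"
    and f: "f \<in> Lp_fun p T" and g: "g \<in> Lp_fun p T"
  shows "(\<lambda>t. f t - g t) \<in> Lp_fun p T"
proof -
  have lusin: "lusin_measurable T (\<lambda>t. f t - g t)"
    using f g by (intro lusin_measurable_diff T) (auto simp: Lp_fun_def)
  have "(\<lambda>t. q (f t - g t)) \<in> Lp_real p" if q: "continuous_seminorm T q" for q
  proof -
    have meas: "(\<lambda>t. q (f t - g t)) \<in> borel_measurable (lebesgue_on {0..1})"
      using lusin_measurable_continuous_compose[OF lusin continuous_seminormD(2)[OF q]]
      by (rule lusin_measurable_imp_borel_measurable)
    have "\<bar>q (f t - g t)\<bar> powr p \<le> 2 powr p * (q (f t) powr p + q (g t) powr p)" for t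
    proof -
      have "\<bar>q (f t - g t)\<bar> powr p \<le> (q (f t) + q (g t)) powr p"
        using q p by (intro powr_mono2) (auto simp: continuous_seminorm_def seminorm_nonneg seminorm_diff_le)
      also have "\<dots> \<le> 2 powr p * (q (f t) powr p + q (g t) powr p)"
        using q p by (intro powr_add_le) (auto simp: continuous_seminorm_def seminorm_nonneg)
      finally show ?thesis .
    qed
    then have bound: "norm (\<bar>q (f t - g t)\<bar> powr p) \<le> norm (2 powr p * (q (f t) powr p + q (g t) powr p))" for t
      by (metis norm_ge_zero abs_of_nonneg order_trans powr_ge_zero real_norm_def)
    have "integrable (lebesgue_on {0..1}) (\<lambda>t. 2 powr p * (q (f t) powr p + q (g t) powr p))"
      using Lp_funD(2)[OF f q] Lp_funD(2)[OF g q] by simp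
    moreover have "(\<lambda>t. \<bar>q (f t - g t)\<bar> powr p) \<in> borel_measurable (lebesgue_on {0..1})"
      using meas by measurable
    ultimately have "integrable (lebesgue_on {0..1}) (\<lambda>t. \<bar>q (f t - g t)\<bar> powr p)"
      by (rule Bochner_Integration.integrable_bound) (intro AE_I2 bound)
    with meas show ?thesis
      by (simp add: Lp_real_def)
  qed
  with lusin show ?thesis
    by (simp add: Lp_fun_def)
qed

section \<open>Almost everywhere classes and convergence in the quotient\<close>

lemma Lp_seminorm_cong_AE:
  assumes T: "locally_convex_topology T" and p: "0 \<le> p" and q: "continuous_seminorm T q"
    and f: "f \<in> Lp_fun p T" and g: "g \<in> Lp_fun p T" and h: "h \<in> Lp_fun p T" and ae: "ae_eq f g"
  shows "Lp_seminorm p q (\<lambda>t. f t - h t) = Lp_seminorm p q (\<lambda>t. g t - h t)"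
proof -
  have "(\<integral>t. q (f t - h t) powr p \<partial>(lebesgue_on {0..1})) = (\<integral>t. q (g t - h t) powr p \<partial>(lebesgue_on {0..1}))"
  proof (rule integral_cong_AE)
    show "AE t in lebesgue_on {0..1}. q (f t - h t) powr p = q (g t - h t) powr p"
      using ae unfolding ae_eq_def by eventually_elim simp
  qed (use Lp_funD(2)[OF Lp_fun_diff[OF T p f h] q] Lp_funD(2)[OF Lp_fun_diff[OF T p g h] q] in auto)
  then show ?thesis
    by (simp add: Lp_seminorm_def)
qed

text \<open>A class lies in the image of a ball as soon as some representative lies in the ball;
  invariance of the seminorm under almost everywhere equality passes this on to the given
  representative u.\<close>

lemma Lp_class_in_ball_iff:
  assumes T: "locally_convex_topology T" and p: "0 \<le> p" and q: "continuous_seminorm T q"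
    and u: "u \<in> Lp_fun p T" and h: "h \<in> Lp_fun p T"
  shows "Lp_class p T u \<in> Lp_class p T ` {g \<in> Lp_fun p T. Lp_seminorm p q (\<lambda>t. g t - h t) < e} \<longleftrightarrow>
    Lp_seminorm p q (\<lambda>t. u t - h t) < e"
proof
  assume "Lp_class p T u \<in> Lp_class p T ` {g \<in> Lp_fun p T. Lp_seminorm p q (\<lambda>t. g t - h t) < e}"
  then obtain g where g: "Lp_class p T u = Lp_class p T g" "g \<in> Lp_fun p T"
    "Lp_seminorm p q (\<lambda>t. g t - h t) < e" by auto
  have "g \<in> Lp_class p T g"
    using g(2) by (simp add: Lp_class_def Lp_rel_def ae_eq_def)
  then have "ae_eq u g"
    unfolding g(1)[symmetric] by (simp add: Lp_class_def Lp_rel_def)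
  with g h u show "Lp_seminorm p q (\<lambda>t. u t - h t) < e"
    by (simp add: Lp_seminorm_cong_AE[OF T p q, of u g h])
qed (use u in auto)

text \<open>Being eventually inside survives finite intersections and arbitrary unions, so testing
  subbasic sets is enough. The condition \<open>l \<in> \<Union>S\<close> says that l belongs to the
  underlying space.\<close>

lemma limitin_topology_generated_by:
  "limitin (topology_generated_by S) f l F \<longleftrightarrow>
    l \<in> \<Union>S \<and> (\<forall>U\<in>S. l \<in> U \<longrightarrow> (\<forall>\<^sub>F n in F. f n \<in> U))"
proof safe
  assume lim: "limitin (topology_generated_by S) f l F"
  then show "l \<in> \<Union>S"
    by (simp add: limitin_def)
  show "\<forall>\<^sub>F n in F. f n \<in> U" if "U \<in> S" "l \<in> U" for U
    using lim that by (simp add: limitin_def topology_generated_by_Basis)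
next
  fix W
  assume ev: "\<forall>U\<in>S. l \<in> U \<longrightarrow> (\<forall>\<^sub>F n in F. f n \<in> U)" and "l \<in> W" "W \<in> S"
  have "\<forall>\<^sub>F n in F. f n \<in> U" if "generate_topology_on S U" "l \<in> U" for U
    using that
  proof induction
    case (Int a b)
    then show ?case by (auto intro: eventually_conj)
  next
    case (UN K)
    then obtain k where "k \<in> K" "l \<in> k" by blast
    with UN.IH have "\<forall>\<^sub>F n in F. f n \<in> k" by blast
    then show ?case
      by eventually_elim (use \<open>k \<in> K\<close> in blast)
  qed (use ev in auto)
  then show "limitin (topology_generated_by S) f l F"
    using \<open>l \<in> W\<close> \<open>W \<in> S\<close> by (auto simp: limitin_def openin_topology_generated_by_iff)
qed

text \<open>Moves convergence from classes to representatives. The centre h stays arbitrary because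
  the generating balls have arbitrary centres.\<close>

lemma Lp_limit_iff:
  assumes T: "locally_convex_topology T" and p: "0 \<le> p"
    and f: "\<And>n. f n \<in> Lp_fun p T" and g: "g \<in> Lp_fun p T"
  shows "Lp_limit p T f g \<longleftrightarrow>
    (\<forall>q h e. continuous_seminorm T q \<and> h \<in> Lp_fun p T \<and> Lp_seminorm p q (\<lambda>t. g t - h t) < e \<longrightarrow>
      (\<forall>\<^sub>F n in sequentially. Lp_seminorm p q (\<lambda>t. f n t - h t) < e))"
    (is "_ \<longleftrightarrow> ?R")
proof -
  let ?B = "\<lambda>q h e. Lp_class p T ` {g \<in> Lp_fun p T. Lp_seminorm p q (\<lambda>t. g t - h t) < e}"
  \<comment> \<open>The zero seminorm provides a ball around g, so the class of g is a point of the
    generated space.\<close>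
  have zero: "continuous_seminorm T (\<lambda>_. 0)"
    by (simp add: continuous_seminorm_def seminorm_def)
  have "Lp_class p T g \<in> ?B (\<lambda>_. 0) g 1"
    using g by (simp add: Lp_class_in_ball_iff[OF T p zero] Lp_seminorm_def)
  then have ne: "Lp_class p T g \<in> \<Union>{?B q h e | q h e. continuous_seminorm T q \<and> h \<in> Lp_fun p T \<and> 0 < e}"
    using zero g zero_less_one by blast
  \<comment> \<open>A radius exceeding a value of \<open>Lp_seminorm\<close> is automatically
    positive, which is why the right-hand side does not ask for it.\<close>
  have pos: "0 < e" if "Lp_seminorm p q u < e" for q u and e :: real
    using that by (simp add: Lp_seminorm_def le_less_trans[OF powr_ge_zero])
  have in_ball: "Lp_class p T u \<in> ?B q h e \<longleftrightarrow> Lp_seminorm p q (\<lambda>t. u t - h t) < e"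
    if "continuous_seminorm T q" "h \<in> Lp_fun p T" "u \<in> Lp_fun p T" for q h u e
    by (rule Lp_class_in_ball_iff[OF T p that(1) that(3) that(2)])
  let ?S = "{?B q h e | q h e. continuous_seminorm T q \<and> h \<in> Lp_fun p T \<and> 0 < e}"
  have "Lp_limit p T f g \<longleftrightarrow>
      (\<forall>U\<in>?S. Lp_class p T g \<in> U \<longrightarrow> (\<forall>\<^sub>F n in sequentially. Lp_class p T (f n) \<in> U))" (is "_ \<longleftrightarrow> ?L")
    unfolding Lp_limit_def Lp_topology_def limitin_topology_generated_by by (simp only: ne simp_thms)
  also have "?L \<longleftrightarrow> ?R"
  proof
    assume L: ?L
    show ?R
    proof (intro allI impI)
      fix q h e
      assume *: "continuous_seminorm T q \<and> h \<in> Lp_fun p T \<and> Lp_seminorm p q (\<lambda>t. g t - h t) < e"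
      with pos have "?B q h e \<in> ?S"
        by blast
      then have "Lp_class p T g \<in> ?B q h e \<longrightarrow> (\<forall>\<^sub>F n in sequentially. Lp_class p T (f n) \<in> ?B q h e)"
        using L by (rule bspec[rotated])
      with * show "\<forall>\<^sub>F n in sequentially. Lp_seminorm p q (\<lambda>t. f n t - h t) < e"
        by (simp only: in_ball f g simp_thms)
    qed
  next
    assume R: ?R
    show ?L
    proof (intro ballI impI)
      fix U assume "U \<in> ?S" and U: "Lp_class p T g \<in> U"
      then obtain q h e where *: "U = ?B q h e" "continuous_seminorm T q" "h \<in> Lp_fun p T" "0 < e"
        by blast
      with U have "Lp_seminorm p q (\<lambda>t. g t - h t) < e"
        by (simp only: in_ball f g)
      with * R have "\<forall>\<^sub>F n in sequentially. Lp_seminorm p q (\<lambda>t. f n t - h t) < e"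
        by blast
      with * show "\<forall>\<^sub>F n in sequentially. Lp_class p T (f n) \<in> U"
        by (simp only: in_ball f g)
    qed
  qed
  finally show ?thesis .
qed

lemma Lp_limitD:
  assumes T: "locally_convex_topology T" and p: "0 \<le> p"
    and f: "\<And>n. f n \<in> Lp_fun p T" and g: "g \<in> Lp_fun p T" and q: "continuous_seminorm T q"
    and lim: "Lp_limit p T f g" and "0 < e"
  shows "\<forall>\<^sub>F n in sequentially. Lp_seminorm p q (\<lambda>t. f n t - g t) < e"
proof -
  have "Lp_seminorm p q (\<lambda>t. g t - g t) < e"
    using \<open>0 < e\<close> q by (simp add: Lp_seminorm_def seminorm_zero continuous_seminorm_def)
  with lim q g show ?thesis
    unfolding Lp_limit_iff[OF T p f g] by blast
qed

lemma Lp_seminorm_powr: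
  assumes "0 < p"
  shows "Lp_seminorm p q f powr p = (\<integral>t. q (f t) powr p \<partial>(lebesgue_on {0..1}))"
  using assms by (simp add: Lp_seminorm_def powr_powr integral_nonneg_AE)

subsection \<open>Metrizable spaces\<close>

text \<open>Metrizability enters only through first countability: each member of a countable base at
  0 contains a ball of some continuous seminorm, and one such seminorm is chosen for each.\<close>

lemma metrizable_locally_convex_seminorm_sequence:
  assumes T: "locally_convex_topology T" and met: "metrizable_space T"
  obtains c :: "nat \<Rightarrow> 'a::real_vector \<Rightarrow> real"
  where "\<forall>n. continuous_seminorm T (c n)"
    and "\<forall>q. continuous_seminorm T q \<longrightarrow> (\<forall>\<delta>>0. \<exists>n e. 0 < e \<and> (\<forall>y. c n y < e \<longrightarrow> q y < \<delta>))"
proof -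
  have top: "topspace T = UNIV"
    by (rule locally_convex_topspace[OF T])
  obtain \<B> where \<B>: "countable \<B>" "\<forall>V\<in>\<B>. openin T V"
    and base: "\<forall>U. openin T U \<and> 0 \<in> U \<longrightarrow> (\<exists>V\<in>\<B>. 0 \<in> V \<and> V \<subseteq> U)"
    using bspec[OF metrizable_imp_first_countable[OF met, unfolded first_countable_def top] UNIV_I[of 0]]
    by (elim exE conjE)
  define \<B>\<^sub>0 where "\<B>\<^sub>0 = {V \<in> \<B>. 0 \<in> V}"
  have "countable \<B>\<^sub>0"
    using \<B>(1) by (simp add: \<B>\<^sub>0_def)
  \<comment> \<open>Nonemptiness is what makes \<open>from_nat_into\<close> take its values in the
    countable family.\<close>
  have "openin T UNIV"
    using openin_topspace[of T] by (simp add: top)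
  then have "\<B>\<^sub>0 \<noteq> {}"
    using spec[OF base, of UNIV] by (auto simp: \<B>\<^sub>0_def)
  have "\<exists>q e. continuous_seminorm T q \<and> 0 < e \<and> {y. q (y - 0) < e} \<subseteq> V" if "V \<in> \<B>\<^sub>0" for V
  proof -
    have "openin T V" "0 \<in> V"
      using \<B>(2) that by (auto simp: \<B>\<^sub>0_def)
    then show ?thesis
      unfolding openin_locally_convex[OF T] by (rule bspec)
  qed
  then have "\<forall>V\<in>\<B>\<^sub>0. \<exists>q e. continuous_seminorm T q \<and> 0 < e \<and> {y. q y < e} \<subseteq> V"
    by simp
  then obtain r where "\<forall>V\<in>\<B>\<^sub>0. \<exists>e. continuous_seminorm T (r V) \<and> 0 < e \<and> {y. r V y < e} \<subseteq> V"
    by (rule bchoice[THEN exE])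
  then obtain e where re: "\<forall>V\<in>\<B>\<^sub>0. continuous_seminorm T (r V) \<and> 0 < e V \<and> {y. r V y < e V} \<subseteq> V"
    by (rule bchoice[THEN exE])
  let ?V = "from_nat_into \<B>\<^sub>0"
  have V: "?V n \<in> \<B>\<^sub>0" for n
    using \<open>\<B>\<^sub>0 \<noteq> {}\<close> by (rule from_nat_into)
  show ?thesis
  proof (rule that[of "\<lambda>n. r (?V n)"])
    show "\<forall>n. continuous_seminorm T (r (?V n))"
      using re V by blast
    have "\<exists>n e. 0 < e \<and> (\<forall>y. r (?V n) y < e \<longrightarrow> q y < \<delta>)" if q: "continuous_seminorm T q" "0 < \<delta>" for q \<delta>
    proof -
      have "openin T {y. q y < \<delta>}"
        using openin_seminorm_ball[OF T q(1), of 0 \<delta>] by simp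
      moreover have "0 \<in> {y. q y < \<delta>}"
        using q by (simp add: continuous_seminorm_def seminorm_zero)
      ultimately obtain W where W: "W \<in> \<B>" "0 \<in> W" "W \<subseteq> {y. q y < \<delta>}"
        using base by blast
      then obtain n where "?V n = W"
        using from_nat_into_surj[OF \<open>countable \<B>\<^sub>0\<close>, of W] by (auto simp: \<B>\<^sub>0_def)
      with W bspec[OF re V, of n] show ?thesis
        by (intro exI[of _ n] exI[of _ "e W"]) auto
    qed
    then show "\<forall>q. continuous_seminorm T q \<longrightarrow>
        (\<forall>\<delta>>0. \<exists>n e. 0 < e \<and> (\<forall>y. r (?V n) y < e \<longrightarrow> q y < \<delta>))"
      by blast
  qed
qed

text \<open>The diagonal choice: the requirement on the k-th index varies with k, and each index is
  also taken beyond the previous one.\<close>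

lemma strict_mono_choice:
  assumes "\<And>k. \<forall>\<^sub>F n in sequentially. P k n"
  obtains s :: "nat \<Rightarrow> nat" where "strict_mono s" "\<forall>k. P k (s k)"
proof -
  have "\<exists>s. \<forall>k. P k (s k) \<and> s k < s (Suc k)"
  proof (rule dependent_nat_choice)
    show "\<exists>n. P 0 n"
      using assms[of 0] by (auto simp: eventually_sequentially)
    show "\<exists>m. P (Suc k) m \<and> n < m" for n k
      using eventually_happens'[OF _ eventually_conj[OF assms[of "Suc k"] eventually_gt_at_top[of n]]] by simp
  qed
  then show ?thesis
    using that by (auto simp: strict_mono_Suc_iff)
qed

text \<open>
  Increasing finite sums of a defining sequence of seminorms let one choice of indices, made
  diagonally, serve all continuous seminorms at once.
\<close>

lemma metrizable_Lp_ae_subsequence_property: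
  assumes T: "locally_convex_topology T" and met: "metrizable_space T" and p: "0 < p"
  shows "Lp_ae_subsequence_property p T"
  unfolding Lp_ae_subsequence_property_def
proof (intro allI impI, elim conjE)
  fix f g
  assume "\<forall>n. f n \<in> Lp_fun p T" and g: "g \<in> Lp_fun p T" and lim: "Lp_limit p T f g"
  then have f: "f n \<in> Lp_fun p T" for n by blast
  have p': "0 \<le> p" using p by simp
  obtain c :: "nat \<Rightarrow> 'a \<Rightarrow> real" where c: "\<forall>n. continuous_seminorm T (c n)"
    and dom: "\<forall>q. continuous_seminorm T q \<longrightarrow> (\<forall>\<delta>>0. \<exists>n e. 0 < e \<and> (\<forall>y. c n y < e \<longrightarrow> q y < \<delta>))"
    by (rule metrizable_locally_convex_seminorm_sequence[OF T met])
  define C where "C k x = (\<Sum>i\<le>k. c i x)" for k x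
  have C: "continuous_seminorm T (C k)" for k
    unfolding C_def[abs_def] by (intro continuous_seminorm_sum spec[OF c]) auto
  have C_nonneg: "0 \<le> C k x" for k x
    using C by (simp add: continuous_seminorm_def seminorm_nonneg)
  have c_le_C: "c n x \<le> C k x" if "n \<le> k" for n k x
    unfolding C_def using that c by (intro member_le_sum) (auto simp: continuous_seminorm_def seminorm_nonneg)
  have "\<forall>\<^sub>F n in sequentially. Lp_seminorm p (C k) (\<lambda>t. f n t - g t) < 1 / real (Suc k)" for k
    by (rule Lp_limitD[OF T p' f g C lim]) simp
  then obtain s where s: "strict_mono s"
    and small: "\<forall>k. Lp_seminorm p (C k) (\<lambda>t. f (s k) t - g t) < 1 / real (Suc k)"
    by (rule strict_mono_choice[where P = "\<lambda>k n. Lp_seminorm p (C k) (\<lambda>t. f n t - g t) < 1 / real (Suc k)"])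
  let ?u = "\<lambda>k t. C k (f (s k) t - g t) powr p"
  have "(\<lambda>k. Lp_seminorm p (C k) (\<lambda>t. f (s k) t - g t)) \<longlonglongrightarrow> 0"
  proof (rule tendsto_sandwich[where f = "\<lambda>_. 0"])
    show "\<forall>\<^sub>F k in sequentially. 0 \<le> Lp_seminorm p (C k) (\<lambda>t. f (s k) t - g t)"
      by (simp add: Lp_seminorm_def)
    show "\<forall>\<^sub>F k in sequentially. Lp_seminorm p (C k) (\<lambda>t. f (s k) t - g t) \<le> 1 / real (Suc k)"
      using small by (intro always_eventually allI less_imp_le) blast
    show "(\<lambda>k. 1 / real (Suc k)) \<longlonglongrightarrow> 0"
      by (rule LIMSEQ_Suc[OF lim_1_over_n])
  qed simp
  then have "(\<lambda>k. Lp_seminorm p (C k) (\<lambda>t. f (s k) t - g t) powr p) \<longlonglongrightarrow> 0"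
    using p by (intro tendsto_zero_powrI[of _ _ "\<lambda>_. p" p]) (auto simp: Lp_seminorm_def)
  then have "(\<lambda>k. \<integral>t. norm (?u k t) \<partial>(lebesgue_on {0..1})) \<longlonglongrightarrow> 0"
    by (simp add: Lp_seminorm_powr[OF p])
  moreover have "integrable (lebesgue_on {0..1}) (?u k)" for k
    by (rule Lp_funD(2)[OF Lp_fun_diff[OF T p' f g] C])
  \<comment> \<open>Only one scalar sequence is involved, its seminorm changing with k, so a single
    null set serves every continuous seminorm.\<close>
  ultimately obtain r where r: "strict_mono r" "AE t in lebesgue_on {0..1}. (\<lambda>k. ?u (r k) t) \<longlonglongrightarrow> 0"
    using tendsto_L1_AE_subseq[of "lebesgue_on {0..1}" ?u] by blast
  have "limitin T (\<lambda>k. f (s (r k)) t) (g t) sequentially" if u: "(\<lambda>k. ?u (r k) t) \<longlonglongrightarrow> 0" for t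
    unfolding limitin_locally_convex[OF T]
  proof (intro allI impI)
    let ?y = "\<lambda>k. f (s (r k)) t - g t"
    fix q assume q: "continuous_seminorm T q"
    have "(\<lambda>k. ?u (r k) t powr (1/p)) \<longlonglongrightarrow> 0"
      using u p by (intro tendsto_zero_powrI[of _ _ "\<lambda>_. 1/p" "1/p"]) auto
    then have lim0: "(\<lambda>k. C (r k) (?y k)) \<longlonglongrightarrow> 0"
      using p by (simp add: powr_powr C_nonneg)
    have "\<forall>\<^sub>F k in sequentially. q (?y k) < \<delta>" if "0 < \<delta>" for \<delta>
    proof -
      obtain n e where e: "0 < e" "\<forall>y. c n y < e \<longrightarrow> q y < \<delta>"
        using dom q \<open>0 < \<delta>\<close> by blast
      have "\<forall>\<^sub>F k in sequentially. C (r k) (?y k) < e"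
        using lim0 e(1) by (rule order_tendstoD)
      then show ?thesis
        using eventually_ge_at_top[of n]
      proof eventually_elim
        case (elim k)
        \<comment> \<open>A strictly increasing r satisfies k \<le> r k, so \<open>c n\<close> is
          one of the summands of \<open>C (r k)\<close>.\<close>
        have "n \<le> r k"
          using elim(2) seq_suble[OF r(1), of k] by linarith
        then show ?case
          using c_le_C[of n "r k" "?y k"] elim(1) e(2) by force
      qed
    qed
    then show "(\<lambda>k. q (?y k)) \<longlonglongrightarrow> 0"
      using q by (auto simp: tendsto_iff continuous_seminorm_def seminorm_nonneg)
  qed
  with r(2) have "AE t in lebesgue_on {0..1}. limitin T (\<lambda>k. f ((s \<circ> r) k) t) (g t) sequentially"
    by (auto elim!: eventually_mono)
  then show "\<exists>r. strict_mono r \<and> (AE t in lebesgue_on {0..1}. limitin T (\<lambda>k. f (r k) t) (g t) sequentially)"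
    using strict_mono_o[OF s r(1)] by blast
qed

text \<open>A subsequence converges almost everywhere to g and, as a subsequence, everywhere on
  [0,1] to h; limits in a metrizable space are unique.\<close>

lemma metrizable_Lp_pointwise_limit_property:
  assumes T: "locally_convex_topology T" and met: "metrizable_space T" and p: "0 < p"
  shows "Lp_pointwise_limit_property p T"
  unfolding Lp_pointwise_limit_property_def
proof (intro allI impI, elim conjE)
  fix f g h
  assume "\<forall>n. f n \<in> Lp_fun p T" "g \<in> Lp_fun p T" "Lp_limit p T f g"
    and h: "\<forall>t\<in>{0..1}. limitin T (\<lambda>n. f n t) (h t) sequentially"
  then obtain r where r: "strict_mono r"
    and ae: "AE t in lebesgue_on {0..1}. limitin T (\<lambda>k. f (r k) t) (g t) sequentially"
    using metrizable_Lp_ae_subsequence_property[OF assms] unfolding Lp_ae_subsequence_property_def by blast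
  show "ae_eq h g"
    unfolding ae_eq_def using ae AE_space
  proof eventually_elim
    case (elim t)
    then have "limitin T ((\<lambda>n. f n t) \<circ> r) (h t) sequentially"
      using h by (intro limitin_subsequence[OF r]) auto
    with elim(1) show ?case
      using metrizable_imp_Hausdorff_space[OF met]
      by (intro limitin_Hausdorff_unique[of T]) (auto simp: comp_def)
  qed
qed

subsection \<open>The space of real functions with pointwise convergence\<close>

text \<open>Lusin-measurability holds with K = [0,1] for every \<epsilon>. By compactness
  \<open>q (f t)\<close> is bounded, hence p-integrable on a set of finite measure.\<close>

lemma continuous_imp_Lp_fun:
  assumes T: "locally_convex_topology T" and p: "0 \<le> p" and f: "continuous_map (top_of_set {0..1}) T f"
  shows "f \<in> Lp_fun p T"
proof -
  have lusin: "lusin_measurable T f"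
    using f unfolding lusin_measurable_def by (auto intro!: exI[of _ "{0..1}"])
  have "(\<lambda>t. q (f t)) \<in> Lp_real p" if q: "continuous_seminorm T q" for q
  proof -
    have meas: "(\<lambda>t. q (f t)) \<in> borel_measurable (lebesgue_on {0..1})"
      using lusin_measurable_continuous_compose[OF lusin continuous_seminormD(2)[OF q]]
      by (rule lusin_measurable_imp_borel_measurable)
    have "continuous_map (top_of_set {0..1}) euclideanreal (\<lambda>t. q (f t))"
      using continuous_map_compose[OF f continuous_seminormD(2)[OF q]] by (simp add: comp_def)
    then have "continuous_on {0..1} (\<lambda>t. q (f t))"
      by simp
    then have "bounded ((\<lambda>t. q (f t)) ` {0..1})"
      by (intro compact_imp_bounded compact_continuous_image) auto
    then obtain B where B: "\<And>t. t \<in> {0..1} \<Longrightarrow> \<bar>q (f t)\<bar> \<le> B"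
      by (force simp: bounded_iff)
    interpret finite_measure "lebesgue_on {0..1::real}"
      by (rule finite_measure_lebesgue_on) simp
    have "integrable (lebesgue_on {0..1}) (\<lambda>t. \<bar>q (f t)\<bar> powr p)"
    proof (rule integrable_const_bound)
      show "AE t in lebesgue_on {0..1}. norm (\<bar>q (f t)\<bar> powr p) \<le> B powr p"
        using B p by (intro AE_I2) (auto intro: powr_mono2)
    qed (use meas in measurable)
    with meas show ?thesis
      by (simp add: Lp_real_def)
  qed
  with lusin show ?thesis
    by (simp add: Lp_fun_def)
qed

lemma AE_lebesgue_on_not_in_finite:
  assumes "finite S"
  shows "AE t in lebesgue_on {0..1}. t \<notin> (S :: real set)"
proof -
  have "AE t in lebesgue. t \<notin> S"
    using assms by (intro AE_not_in null_sets_completionI finite_imp_null_set_lborel)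
  then show ?thesis
    by (subst AE_restrict_space_iff) auto
qed

lemma eval_seminorm: "seminorm (eval_seminorm x)"
  by (simp add: seminorm_def eval_seminorm_def scaleR_fun_def abs_mult abs_triangle_ineq)

lemma seminorm_range_eval: "\<forall>q \<in> range eval_seminorm. seminorm q"
  by (auto simp: eval_seminorm)

lemma locally_convex_E: "locally_convex_topology E_topology"
  unfolding locally_convex_topology_def E_topology_def using seminorm_range_eval by blast

lemma continuous_eval_seminorm: "continuous_seminorm E_topology (eval_seminorm x)"
  unfolding E_topology_def by (intro continuous_seminormI[OF seminorm_range_eval]) simp

text \<open>Homogeneity turns a neighbourhood of 0 cut out by finitely many evaluations into a
  linear bound. The case c = 0 is included deliberately: q vanishes on functions that vanish on
  S.\<close>

lemma continuous_seminorm_E_bound: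
  assumes q: "continuous_seminorm E_topology q"
  obtains S B where "finite S" "0 \<le> B" "\<forall>y c. 0 \<le> c \<and> (\<forall>x\<in>S. \<bar>y x\<bar> \<le> c) \<longrightarrow> q y \<le> B * c"
proof -
  have sq: "seminorm q"
    using q by (simp add: continuous_seminorm_def)
  obtain F e where F: "finite F" "F \<subseteq> range eval_seminorm" "0 < e"
    "\<And>y. (\<And>r. r \<in> F \<Longrightarrow> r y < e) \<Longrightarrow> q y < 1"
    using continuous_seminorm_ball_at_zero[OF seminorm_range_eval q[unfolded E_topology_def] zero_less_one]
    by blast
  obtain S where S: "finite S" "F = eval_seminorm ` S"
    using finite_subset_image[OF F(1,2)] by auto
  \<comment> \<open>Scaling y by e / (2c) brings its values on S down to at most e/2, strictly below
    e as required.\<close>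
  have pos: "q y \<le> 2/e * c" if "0 < c" "\<forall>x\<in>S. \<bar>y x\<bar> \<le> c" for y c
  proof -
    have "q ((e / (2 * c)) *\<^sub>R y) < 1"
    proof (rule F(4))
      fix r assume "r \<in> F"
      then obtain x where x: "x \<in> S" "r = eval_seminorm x"
        using S(2) by blast
      have "e / (2 * c) * \<bar>y x\<bar> \<le> e / (2 * c) * c"
        using that x(1) \<open>0 < e\<close> by (intro mult_left_mono) auto
      also have "\<dots> < e"
        using that \<open>0 < e\<close> by simp
      finally show "r ((e / (2 * c)) *\<^sub>R y) < e"
        using that \<open>0 < e\<close> by (simp add: x(2) eval_seminorm_def scaleR_fun_def abs_mult)
    qed
    then show ?thesis
      using that(1) \<open>0 < e\<close> by (simp add: seminorm_scaleR[OF sq] field_simps)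
  qed
  \<comment> \<open>The case c = 0 cannot be rescaled. It is reached by enlarging c by e * d / 2,
    which costs exactly d in the bound.\<close>
  have "q y \<le> 2/e * c" if "0 \<le> c" "\<forall>x\<in>S. \<bar>y x\<bar> \<le> c" for y c
  proof (rule field_le_epsilon)
    fix d :: real assume "0 < d"
    then have "q y \<le> 2/e * (c + e * d / 2)"
      using that \<open>0 < e\<close> by (intro pos) (auto intro: add_nonneg_pos order_trans)
    then show "q y \<le> 2/e * c + d"
      using \<open>0 < e\<close> by (simp add: field_simps)
  qed
  with S(1) \<open>0 < e\<close> show ?thesis
    by (intro that[of S "2/e"]) auto
qed

lemma limitin_E_iff: "limitin E_topology f l F \<longleftrightarrow> (\<forall>x. ((\<lambda>n. f n x) \<longlongrightarrow> l x) F)"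
proof
  assume lim: "limitin E_topology f l F"
  show "\<forall>x. ((\<lambda>n. f n x) \<longlongrightarrow> l x) F"
  proof
    fix x
    have "((\<lambda>n. eval_seminorm x (f n - l)) \<longlongrightarrow> 0) F"
      using lim continuous_eval_seminorm unfolding limitin_locally_convex[OF locally_convex_E] by blast
    then show "((\<lambda>n. f n x) \<longlongrightarrow> l x) F"
      by (simp add: eval_seminorm_def tendsto_rabs_zero_iff LIM_zero_iff)
  qed
next
  assume lim: "\<forall>x. ((\<lambda>n. f n x) \<longlongrightarrow> l x) F"
  show "limitin E_topology f l F"
    unfolding limitin_locally_convex[OF locally_convex_E]
  proof (intro allI impI)
    fix q assume q: "continuous_seminorm E_topology q"
    obtain S B where SB: "finite S" "0 \<le> B" "\<forall>y c. 0 \<le> c \<and> (\<forall>x\<in>S. \<bar>y x\<bar> \<le> c) \<longrightarrow> q y \<le> B * c"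
      using q by (rule continuous_seminorm_E_bound)
    \<comment> \<open>The sum over S plays the part of c in the linear bound, being at least each of
      its terms.\<close>
    have "\<forall>x\<in>S. \<bar>(f n - l) x\<bar> \<le> (\<Sum>x\<in>S. \<bar>f n x - l x\<bar>)" for n
      using SB(1) by (auto intro: member_le_sum)
    then have le: "q (f n - l) \<le> B * (\<Sum>x\<in>S. \<bar>f n x - l x\<bar>)" for n
      using SB(3) by (simp add: sum_nonneg)
    have "((\<lambda>n. f n x - l x) \<longlongrightarrow> 0) F" for x
      using lim by (simp add: LIM_zero_iff)
    then have "((\<lambda>n. B * (\<Sum>x\<in>S. \<bar>f n x - l x\<bar>)) \<longlongrightarrow> 0) F"
      by (intro tendsto_mult_right_zero tendsto_null_sum tendsto_rabs_zero)
    then show "((\<lambda>n. q (f n - l)) \<longlongrightarrow> 0) F"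
      by (rule tendsto_sandwich[where f = "\<lambda>_. 0", rotated 3])
        (use q le in \<open>auto simp: continuous_seminorm_def seminorm_nonneg\<close>)
  qed
qed

lemma Hausdorff_E: "Hausdorff_space E_topology"
  unfolding Hausdorff_space_def
proof (intro allI impI, elim conjE)
  fix f g :: "real \<Rightarrow> real" assume "f \<noteq> g"
  then obtain x where x: "f x \<noteq> g x" by auto
  let ?U = "\<lambda>f. {y. eval_seminorm x (y - f) < \<bar>f x - g x\<bar> / 2}"
  let ?V = "{y. eval_seminorm x (y - g) < \<bar>f x - g x\<bar> / 2}"
  have "disjnt (?U f) ?V"
    by (auto simp: disjnt_def eval_seminorm_def abs_if split: if_splits)
  moreover have "f \<in> ?U f" "g \<in> ?V"
    using x by (auto simp: eval_seminorm_def)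
  ultimately show "\<exists>U V. openin E_topology U \<and> openin E_topology V \<and> f \<in> U \<and> g \<in> V \<and> disjnt U V"
    using openin_seminorm_ball[OF locally_convex_E continuous_eval_seminorm] by blast
qed

text \<open>The universal property of the product topology, obtained from the domination of q by
  finitely many coordinates.\<close>

lemma continuous_map_E:
  assumes f: "\<And>x. continuous_map X euclideanreal (\<lambda>t. f t x)"
  shows "continuous_map X E_topology f"
  unfolding continuous_map_locally_convex[OF locally_convex_E]
proof (intro allI impI, elim conjE)
  fix q s and e :: real
  assume q: "continuous_seminorm E_topology q" and s: "s \<in> topspace X" and "0 < e"
  obtain S B where SB: "finite S" "0 \<le> B" "\<forall>y c. 0 \<le> c \<and> (\<forall>x\<in>S. \<bar>y x\<bar> \<le> c) \<longrightarrow> q y \<le> B * c"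
    using q by (rule continuous_seminorm_E_bound)
  let ?g = "\<lambda>t. B * (\<Sum>x\<in>S. \<bar>f t x - f s x\<bar>)"
  have "\<forall>x\<in>S. \<bar>(f t - f s) x\<bar> \<le> (\<Sum>x\<in>S. \<bar>f t x - f s x\<bar>)" for t
    using SB(1) by (auto intro: member_le_sum)
  then have le: "q (f t - f s) \<le> ?g t" for t
    using SB(3) by (simp add: sum_nonneg)
  have "continuous_map X euclideanreal ?g"
    using f SB(1) by (intro continuous_intros) auto
  then have "openin X {t \<in> topspace X. ?g t \<in> {..<e}}"
    by (rule openin_continuous_map_preimage) auto
  moreover have "s \<in> {t \<in> topspace X. ?g t \<in> {..<e}}"
    using s \<open>0 < e\<close> by simp
  moreover have "q (f t - f s) < e" if "t \<in> {t \<in> topspace X. ?g t \<in> {..<e}}" for t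
    using le[of t] that by auto
  ultimately show "\<exists>U. openin X U \<and> s \<in> U \<and> (\<forall>t\<in>U. q (f t - f s) < e)"
    by blast
qed

section \<open>The tent functions and their limits\<close>

lemma zero_E_in_Lp_fun: "0 \<le> p \<Longrightarrow> zero_E \<in> Lp_fun p E_topology"
  by (intro continuous_imp_Lp_fun locally_convex_E continuous_map_E) (simp_all add: zero_E_def)

text \<open>For fixed x the coordinate is continuous in t. The index n = 0 gives the constant
  function 1, so \<open>tent\<close> is a sequence in the space from its first term on.\<close>

lemma tent_in_Lp_fun: "0 \<le> p \<Longrightarrow> tent n \<in> Lp_fun p E_topology"
  by (intro continuous_imp_Lp_fun locally_convex_E continuous_map_E)
    (auto simp: tent_def intro!: continuous_intros)

lemma tent_diag: "tent n t t = 1"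
  by (simp add: tent_def)

lemma tent_nonneg: "0 \<le> tent n t x"
  by (simp add: tent_def)

lemma tent_le_one: "tent n t x \<le> 1"
  by (simp add: tent_def)

lemma tent_eventually_zero:
  assumes "x \<noteq> t"
  shows "\<forall>\<^sub>F n in sequentially. tent n t x = 0"
proof -
  obtain N where N: "1 / \<bar>x - t\<bar> < real N"
    using reals_Archimedean2 by blast
  have "tent n t x = 0" if "N \<le> n" for n
  proof -
    have "1 / \<bar>x - t\<bar> < real n"
      using N that by linarith
    then have "1 < real n * \<bar>x - t\<bar>"
      using assms by (simp add: field_simps)
    then show ?thesis
      by (simp add: tent_def)
  qed
  then show ?thesis
    by (auto simp: eventually_sequentially)
qed

lemma tent_tendsto_spike: "limitin E_topology (\<lambda>n. tent n t) (spike t) sequentially"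
  unfolding limitin_E_iff
proof
  fix x
  show "(\<lambda>n. tent n t x) \<longlonglongrightarrow> spike t x"
  proof (cases "x = t")
    case True
    then show ?thesis by (simp add: tent_diag spike_def)
  next
    case False
    then show ?thesis
      using tendsto_eventually[OF tent_eventually_zero[OF False]] by (simp add: spike_def)
  qed
qed

text \<open>The integrand is at most 1 and vanishes outside an interval of length 2/n around x.
  Cutting this interval down to [0,1] is what leaves only an inequality.\<close>

lemma Lp_seminorm_tent_le:
  assumes p: "0 < p" and n: "1 \<le> n"
  shows "Lp_seminorm p (eval_seminorm x) (\<lambda>t. tent n t - zero_E t) powr p \<le> 2 / real n"
proof -
  let ?M = "lebesgue_on {0..1::real}" and ?A = "{x - 1 / real n .. x + 1 / real n}"
  have "integrable ?M (\<lambda>t. eval_seminorm x (tent n t - zero_E t) powr p)"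
    using p by (intro Lp_funD(2)[OF Lp_fun_diff[OF locally_convex_E] continuous_eval_seminorm]
        tent_in_Lp_fun zero_E_in_Lp_fun) auto
  moreover have "?A \<inter> {0..1} \<in> sets ?M"
    by (auto simp: sets_restrict_space Int_commute intro!: imageI)
  then have "integrable ?M (indicat_real (?A \<inter> {0..1}))"
    by (intro integrable_real_indicator) (auto simp: emeasure_restrict_space intro: le_less_trans[OF emeasure_mono[of _ "{0..1}"]])
  moreover have "eval_seminorm x (tent n t - zero_E t) powr p \<le> indicat_real (?A \<inter> {0..1}) t"
    if "t \<in> {0..1}" for t
  proof (cases "t \<in> ?A")
    case True
    then show ?thesis
      using p that tent_nonneg[of n t x] tent_le_one[of n t x]
      by (simp add: eval_seminorm_def zero_E_def powr_le1)
  next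
    case False
    then have "1 / real n \<le> \<bar>x - t\<bar>"
      by auto
    then have "1 \<le> real n * \<bar>x - t\<bar>"
      using n by (simp add: field_simps)
    then show ?thesis
      by (simp add: eval_seminorm_def zero_E_def tent_def)
  qed
  ultimately have "(\<integral>t. eval_seminorm x (tent n t - zero_E t) powr p \<partial>?M) \<le>
      (\<integral>t. indicat_real (?A \<inter> {0..1}) t \<partial>?M)"
    by (intro integral_mono) auto
  also have "\<dots> = measure lebesgue (?A \<inter> {0..1})"
    by (simp add: measure_restrict_space)
  also have "\<dots> \<le> measure lebesgue ?A"
    by (intro measure_mono_fmeasurable) auto
  also have "\<dots> = 2 / real n"
    by simp
  finally show ?thesis
    by (simp add: Lp_seminorm_powr[OF p])
qed

text \<open>By \<open>Lp_limit_iff\<close> it suffices that, for every centre h, the seminorms of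
  \<open>tent n - h\<close> converge to that of \<open>zero_E - h\<close>. Off the finite set S the
  integrands are even eventually equal to the limit.\<close>

lemma Lp_limit_tent:
  assumes p: "0 < p"
  shows "Lp_limit p E_topology tent zero_E"
proof -
  have p': "0 \<le> p" using p by simp
  note T = locally_convex_E
  let ?M = "lebesgue_on {0..1::real}"
  have "(\<lambda>n. Lp_seminorm p q (\<lambda>t. tent n t - h t)) \<longlonglongrightarrow> Lp_seminorm p q (\<lambda>t. zero_E t - h t)"
    if q: "continuous_seminorm E_topology q" and h: "h \<in> Lp_fun p E_topology" for q h
  proof -
    have sq: "seminorm q"
      using q by (simp add: continuous_seminorm_def)
    obtain S B where SB: "finite S" "0 \<le> B" "\<forall>y c. 0 \<le> c \<and> (\<forall>x\<in>S. \<bar>y x\<bar> \<le> c) \<longrightarrow> q y \<le> B * c"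
      using q by (rule continuous_seminorm_E_bound)
    \<comment> \<open>The linear bound with c = 1, uniform in n and t.\<close>
    have q_tent: "q (tent n t) \<le> B" for n t
      using spec[OF spec[OF SB(3), of "tent n t"], of 1] tent_nonneg[of n t] tent_le_one[of n t] by simp
    have ev: "\<forall>\<^sub>F n in sequentially. q (tent n t - h t) powr p = q (zero_E t - h t) powr p" if "t \<notin> S" for t
    proof -
      have "\<forall>\<^sub>F n in sequentially. \<forall>x\<in>S. tent n t x = 0"
        using that by (intro eventually_ball_finite SB(1) ballI tent_eventually_zero) auto
      then show ?thesis
      proof eventually_elim
        case (elim n)
        \<comment> \<open>The linear bound with c = 0, all values on S being zero for this
          n.\<close>
        then have "q (tent n t) \<le> 0"
          using spec[OF spec[OF SB(3), of "tent n t"], of 0] by simp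
        moreover have "\<bar>q (tent n t - h t) - q (zero_E t - h t)\<bar> \<le> q (tent n t)"
          using seminorm_reverse_triangle[OF sq, of "tent n t - h t" "zero_E t - h t"]
          by (simp add: zero_E_def)
        ultimately have "q (tent n t - h t) = q (zero_E t - h t)"
          by linarith
        then show ?case
          by simp
      qed
    qed
    have int: "integrable ?M (\<lambda>t. q (f t - h t) powr p)" if "f \<in> Lp_fun p E_topology" for f
      by (rule Lp_funD(2)[OF Lp_fun_diff[OF T p' that h] q])
    \<comment> \<open>Finiteness of the measure makes the constant \<open>B powr p\<close> in the
      dominating function integrable.\<close>
    interpret finite_measure ?M
      by (rule finite_measure_lebesgue_on) simp
    have "(\<lambda>n. \<integral>t. q (tent n t - h t) powr p \<partial>?M) \<longlonglongrightarrow> (\<integral>t. q (zero_E t - h t) powr p \<partial>?M)"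
    proof (rule integral_dominated_convergence)
      show "integrable ?M (\<lambda>t. 2 powr p * (B powr p + q (h t) powr p))"
        using Lp_funD(2)[OF h q] by simp
      show "AE t in ?M. (\<lambda>n. q (tent n t - h t) powr p) \<longlonglongrightarrow> q (zero_E t - h t) powr p"
        using AE_lebesgue_on_not_in_finite[OF SB(1)]
        by eventually_elim (intro tendsto_eventually ev)
      show "AE t in ?M. norm (q (tent n t - h t) powr p) \<le> 2 powr p * (B powr p + q (h t) powr p)" for n
      proof (rule AE_I2)
        fix t
        have "q (tent n t - h t) \<le> B + q (h t)"
          using seminorm_diff_le[OF sq, of "tent n t" "h t"] q_tent[of n t] by linarith
        then have "q (tent n t - h t) powr p \<le> (B + q (h t)) powr p"
          using p' by (intro powr_mono2) (auto simp: seminorm_nonneg[OF sq])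
        also have "\<dots> \<le> 2 powr p * (B powr p + q (h t) powr p)"
          using p' SB(2) by (intro powr_add_le) (auto simp: seminorm_nonneg[OF sq])
        finally show "norm (q (tent n t - h t) powr p) \<le> 2 powr p * (B powr p + q (h t) powr p)"
          by simp
      qed
    qed (use int tent_in_Lp_fun[OF p'] zero_E_in_Lp_fun[OF p'] in \<open>blast intro: borel_measurable_integrable\<close>)+
    then show ?thesis
      unfolding Lp_seminorm_def using p by (intro tendsto_powr') auto
  qed
  then show ?thesis
    unfolding Lp_limit_iff[OF T p' tent_in_Lp_fun[OF p'] zero_E_in_Lp_fun[OF p']]
    by (intro allI impI, elim conjE, intro order_tendstoD(2)) assumption
qed

section \<open>Incompatibility of the spike function with Lusin-measurability\<close>

text \<open>If every point of A were isolated, A would be covered by open sets meeting it in at most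
  one point each. A countable subcover, which exists by the Lindelof property, would make A
  countable.\<close>

lemma uncountable_imp_islimpt:
  fixes A :: "'a::second_countable_topology set"
  assumes "uncountable A"
  shows "\<exists>x\<in>A. x islimpt A"
proof (rule ccontr)
  assume isolated: "\<not> (\<exists>x\<in>A. x islimpt A)"
  let ?F = "{U. open U \<and> (\<exists>x. A \<inter> U \<subseteq> {x})}"
  obtain F where F: "F \<subseteq> ?F" "countable F" "\<Union>F = \<Union>?F"
    using Lindelof[of ?F] by blast
  have "A \<subseteq> \<Union>?F"
  proof
    fix x assume "x \<in> A"
    then obtain U where "x \<in> U" "open U" "\<forall>y\<in>A. y \<in> U \<longrightarrow> y = x"
      using isolated by (meson islimptI)
    then show "x \<in> \<Union>?F"
      by auto
  qed
  then have "A \<subseteq> \<Union>F"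
    unfolding F(3) .
  then have "A = (\<Union>U\<in>F. A \<inter> U)"
    by blast
  moreover have "countable (A \<inter> U)" if U: "U \<in> F" for U
  proof -
    obtain x where "A \<inter> U \<subseteq> {x}"
      using F(1) U by blast
    then show ?thesis
      by (rule countable_subset) simp
  qed
  ultimately show False
    using assms F(2) by (metis countable_UN)
qed

text \<open>
  A Lusin-measurable map agreeing almost everywhere with \<open>spike\<close> would be continuous on a set of
  positive measure on which it agrees with \<open>spike\<close>; at an accumulation point \<open>s\<close> of this set
  evaluation at \<open>s\<close> jumps.
\<close>

lemma not_ae_eq_spike:
  assumes lusin: "lusin_measurable E_topology \<eta>"
  shows "\<not> ae_eq spike \<eta>"
proof
  assume "ae_eq spike \<eta>"
  then have "AE t in lebesgue. t \<in> {0..1} \<longrightarrow> spike t = \<eta> t"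
    unfolding ae_eq_def by (subst (asm) AE_restrict_space_iff) auto
  then obtain N where N: "N \<in> null_sets lebesgue" "{t. \<not> (t \<in> {0..1} \<longrightarrow> spike t = \<eta> t)} \<subseteq> N"
    by (auto simp: eventually_ae_filter)
  \<comment> \<open>The choice 1/2 stands for any bound below the measure 1 of [0,1]; it prevents K
    from being null.\<close>
  obtain K where K: "compact K" "K \<subseteq> {0..1}" "measure lebesgue ({0..1} - K) \<le> 1/2"
    and cont: "continuous_map (top_of_set K) E_topology \<eta>"
    using lusin unfolding lusin_measurable_def by (meson half_gt_zero zero_less_one)
  \<comment> \<open>Removing the null set N cannot leave a countable rest, since K would then be
    null. Uncountability is what yields an accumulation point inside the set.\<close>
  have "uncountable (K - N)"
  proof
    assume "countable (K - N)"
    then have "K - N \<in> null_sets lebesgue"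
      by (intro null_sets_completionI countable_imp_null_set_lborel)
    then have "(K - N) \<union> N \<in> null_sets lebesgue"
      using N(1) by (rule null_sets.Un)
    moreover have "K \<in> sets lebesgue"
      using K(1) by (intro fmeasurableD lmeasurable_compact)
    ultimately have null: "K \<in> null_sets lebesgue"
      by (rule null_sets_subset) auto
    have "measure lebesgue ({0..1} - K) = measure lebesgue {0..1::real}"
      using null by (intro measure_Diff_null_set) auto
    with K(3) show False
      by simp
  qed
  then obtain s where s: "s \<in> K - N" "s islimpt (K - N)"
    using uncountable_imp_islimpt by blast
  have eq: "\<eta> t = spike t" if "t \<in> K - N" for t
  proof (rule ccontr)
    assume "\<eta> t \<noteq> spike t"
    moreover have "t \<in> {0..1}"
      using that K(2) by blast
    ultimately have "t \<in> {t. \<not> (t \<in> {0..1} \<longrightarrow> spike t = \<eta> t)}"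
      by simp
    with N(2) that show False
      by blast
  qed
  obtain U where U: "openin (top_of_set K) U" "s \<in> U" "\<forall>t\<in>U. eval_seminorm s (\<eta> t - \<eta> s) < 1"
    using cont[unfolded continuous_map_locally_convex[OF locally_convex_E], rule_format,
        of "eval_seminorm s" s 1] continuous_eval_seminorm s(1) by auto
  obtain V where V: "open V" "U = K \<inter> V"
    using U(1) by (auto simp: openin_open)
  then obtain t where t: "t \<in> K - N" "t \<in> V" "t \<noteq> s"
    using s(2) U(2) by (auto simp: islimpt_def)
  then have "eval_seminorm s (\<eta> t - \<eta> s) < 1"
    using U(3) V(2) by auto
  \<comment> \<open>At the coordinate s, \<open>spike s\<close> is 1 and \<open>spike t\<close> is
    0, since t and s differ.\<close>
  moreover have "eval_seminorm s (\<eta> t - \<eta> s) = 1"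
    using t(3) by (simp add: eq[OF t(1)] eq[OF s(1)] eval_seminorm_def spike_def)
  ultimately show False
    by simp
qed

lemma not_AE_False_unit_interval: "\<not> (AE t in lebesgue_on {0..1::real}. False)"
proof
  assume "AE t in lebesgue_on {0..1::real}. False"
  then have "AE t in lebesgue. t \<notin> {0..1::real}"
    by (subst (asm) AE_restrict_space_iff) auto
  then have "{0..1::real} \<in> null_sets lebesgue"
    by (subst AE_iff_null_sets) auto
  then show False
    by (simp add: null_sets_def)
qed

lemma not_AE_tent_tendsto_zero:
  "\<not> (AE t in lebesgue_on {0..1}. limitin E_topology (\<lambda>k. tent (r k) t) (zero_E t) sequentially)"
proof
  have "\<not> limitin E_topology (\<lambda>k. tent (r k) t) (zero_E t) sequentially" for t
    unfolding limitin_E_iff by (auto intro!: exI[of _ t] simp: tent_diag zero_E_def LIMSEQ_const_iff)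
  moreover assume "AE t in lebesgue_on {0..1}. limitin E_topology (\<lambda>k. tent (r k) t) (zero_E t) sequentially"
  ultimately show False
    using not_AE_False_unit_interval by simp
qed

lemma measure_spike_neq_zero: "measure (lebesgue_on {0..1}) {t \<in> {0..1}. spike t \<noteq> zero_E t} = 1"
proof -
  have "spike t \<noteq> zero_E t" for t
    by (auto simp: fun_eq_iff spike_def zero_E_def intro!: exI[of _ t])
  then have "{t \<in> {0..1}. spike t \<noteq> zero_E t} = {0..1}"
    by auto
  then show ?thesis
    by (simp add: measure_restrict_space)
qed

lemma Lp_class_in_Lp_space: "f \<in> Lp_fun p T \<Longrightarrow> Lp_class p T f \<in> Lp_space p T"
  by (simp add: Lp_class_def Lp_space_def quotientI)

theorem mainTheorem6:
  fixes p :: real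
  assumes "1 \<le> p"
  shows
    "locally_convex_topology E_topology \<and> Hausdorff_space E_topology \<and>
     \<not> metrizable_space E_topology \<and>
     (\<forall>t\<in>{0..1}. limitin E_topology (\<lambda>n. tent n t) (spike t) sequentially) \<and>
     (\<forall>n\<ge>1. tent n \<in> Lp_fun p E_topology \<and> Lp_class p E_topology (tent n) \<in> Lp_space p E_topology) \<and>
     zero_E \<in> Lp_fun p E_topology \<and> Lp_class p E_topology zero_E \<in> Lp_space p E_topology \<and>
     (\<forall>n\<ge>1. \<forall>x\<^sub>0. Lp_seminorm p (eval_seminorm x\<^sub>0) (\<lambda>t. tent n t - zero_E t) powr p \<le> 2 / real n) \<and>
     Lp_limit p E_topology tent zero_E \<and>
     measure (lebesgue_on {0..1}) {t \<in> {0..1}. spike t \<noteq> zero_E t} = 1 \<and>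
     \<not> ae_eq spike zero_E \<and>
     (\<forall>r \<eta>. strict_mono r \<and> \<eta> \<in> Lp_fun p E_topology \<and>
        Lp_limit p E_topology (\<lambda>k. tent (r k)) \<eta> \<longrightarrow> \<not> ae_eq spike \<eta>) \<and>
     (\<forall>r. strict_mono r \<longrightarrow>
        \<not> (AE t in lebesgue_on {0..1}.
              limitin E_topology (\<lambda>k. tent (r k) t) (zero_E t) sequentially)) \<and>
     \<not> Lp_ae_subsequence_property p E_topology \<and>
     \<not> Lp_pointwise_limit_property p E_topology \<and>
     (\<forall>F :: 'b::real_vector topology. locally_convex_topology F \<and> metrizable_space F \<longrightarrow>
        Lp_ae_subsequence_property p F \<and> Lp_pointwise_limit_property p F)"
proof -
  note T = locally_convex_E
  from \<open>1 \<le> p\<close> have p: "0 < p" "0 \<le> p" by simp_all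
  note in_Lp = tent_in_Lp_fun[OF p(2)] zero_E_in_Lp_fun[OF p(2)]
  have no_subsequence: "\<not> Lp_ae_subsequence_property p E_topology"
    unfolding Lp_ae_subsequence_property_def
    using in_Lp Lp_limit_tent[OF p(1)] not_AE_tent_tendsto_zero by blast
  \<comment> \<open>Membership in \<open>Lp_fun\<close> already excludes \<eta>, so the clause about
    limits of arbitrary subsequences follows along with the one about \<open>zero_E\<close>.\<close>
  have spike: "\<not> ae_eq spike \<eta>" if "\<eta> \<in> Lp_fun p E_topology" for \<eta>
    using that by (intro not_ae_eq_spike) (simp add: Lp_fun_def)
  have no_pointwise: "\<not> Lp_pointwise_limit_property p E_topology"
    unfolding Lp_pointwise_limit_property_def
    using in_Lp Lp_limit_tent[OF p(1)] tent_tendsto_spike spike[OF in_Lp(2)] by blast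
  have "\<not> metrizable_space E_topology"
    using metrizable_Lp_ae_subsequence_property[OF T _ p(1)] no_subsequence by blast
  moreover have "\<forall>F :: 'b::real_vector topology. locally_convex_topology F \<and> metrizable_space F \<longrightarrow>
      Lp_ae_subsequence_property p F \<and> Lp_pointwise_limit_property p F"
    using metrizable_Lp_ae_subsequence_property metrizable_Lp_pointwise_limit_property p(1) by blast
  ultimately show ?thesis
    using T Hausdorff_E tent_tendsto_spike in_Lp Lp_class_in_Lp_space Lp_seminorm_tent_le[OF p(1)]
      Lp_limit_tent[OF p(1)] measure_spike_neq_zero spike not_AE_tent_tendsto_zero
      no_subsequence no_pointwise
    by (intro conjI) (assumption | blast)+
qed

end
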